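(* Suppose there exist constants $c_0,C_0>0$ such that for all $h>0$, all $y\in\mathbb R^d$ and $\mathbb P_a$-a.e. $Y^a$, $\kappa_{h,\theta_0}(y;Y^a)\le C_0\det\{G_h(Y^a)\}^{1/2}\exp[-c_0\|y-m_h(Y^a)\|^2_{G_h(Y^a)}]$, and let $C=C_0^2(\pi/(2c_0))^{d/2}$. (a) Assume there exist $h_r>0$, a function $r(h)\ge0$ and $C_r<\infty$ with $\mathbb E[\det\{G_h(Y^a)\}^{1/2}]\le C_rh^{-r(h)}$ for all $0<h\le h_r$. Then for every measurable $\mathcal Y_0\subseteq\mathbb R^d$ and $0<h\le h_r$, $h<1$: $H_h(\mathcal Y_0)\le H_h(\mathbb R^d)\le CC_rh^{-r(h)}$ and $$d_{\mathrm{eff}}(h;\mathcal Y_0)\le r(h)+\frac{\log(CC_r\vee1)}{\log(1/h)}.$$ If moreover $\limsup_{h\downarrow0}r(h)\le r_\star$, then $d_{\mathrm{eff}}(h;\mathcal Y_0)\le r_\star+o(1)$ as $h\downarrow0$. (b) Suppose instead that for some integer $d_\star\le d$ there are constants $0<c_1\le c_2<\infty$ and $h_0>0$ such that, $\mathbb P_a$-almost surely, for every $0<h\le h_0$ the eigenvalues $\lambda_1\le\dots\le\lambda_d$ (suitably ordered) of $\Sigma_h(Y^a)=G_h(Y^a)^{-1}$ satisfy $c_1h^2\le\lambda_j\le c_2h^2$ for $j\le d_\star$ and $c_1\le\lambda_j\le c_2$ for $j>d_\star$. Then for every measurable $\mathcal Y_0\subseteq\mathbb R^d$, $H_h(\mathcal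 Y_0)\le H_h(\mathbb R^d)\lesssim h^{-d_\star}$ and $d_{\mathrm{eff}}(h;\mathcal Y_0)\le d_\star+o(1)$ as $h\downarrow0$. If in addition there exist $c_\ell>0$, $h_0'>0$ with $\int_{\mathbb R^d}\kappa_{h,\theta_0}(u;Y^a)^2du\ge c_\ell\det\{G_h(Y^a)\}^{1/2}$ $\mathbb P_a$-a.s. for all $0<h\le h_0'$, then $d_{\mathrm{eff}}(h;\mathbb R^d)=d_\star+o(1)$ as $h\downarrow0$.
   Context: $Y^a$ is a random vector in $\mathbb R^d$ with law $\mathbb P_a$. For each $h>0$ and $u\in\mathbb R^d$, $\kappa_{h,\theta_0}(\cdot;u)\ge0$ is a probability density on $\mathbb R^d$ with finite mean $m_h(u)=\int v\,\kappa_{h,\theta_0}(v;u)dv$ and invertible covariance $\Sigma_h(u)=\int\{v-m_h(u)\}\{v-m_h(u)\}^\top\kappa_{h,\theta_0}(v;u)dv$; $G_h(u)=\Sigma_h(u)^{-1}$ and $\|v\|_G=(v^\top Gv)^{1/2}$. For measurable $\mathcal Y_0\subseteq\mathbb R^d$: $H_h(\mathcal Y_0)=\mathbb E[\int_{\mathcal Y_0}\kappa_{h,\theta_0}(y;Y^a)^2dy]$ and, for $0<h<1$, $d_{\mathrm{eff}}(h;\mathcal Y_0)=\log\{H_h(\mathcal Y_0)\vee1\}/\log(1/h)$. *)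

theory Defs
  imports "HOL-Probability.Probability"
begin

text \<open>The kernel is represented as kappa h v u = kappa_{h,theta0}(v;u) (theta0 fixed).\<close>

definition kmean :: "(real \<Rightarrow> real^'n \<Rightarrow> real^'n \<Rightarrow> real) \<Rightarrow> real \<Rightarrow> real^'n \<Rightarrow> real^'n" where
  "kmean \<kappa> h u = (\<chi> i. LINT v|lborel. \<kappa> h v u * v$i)"

definition kcov :: "(real \<Rightarrow> real^'n \<Rightarrow> real^'n \<Rightarrow> real) \<Rightarrow> real \<Rightarrow> real^'n \<Rightarrow> real^'n^'n" where
  "kcov \<kappa> h u = (\<chi> i j. LINT v|lborel.
      \<kappa> h v u * ((v$i - kmean \<kappa> h u $ i) * (v$j - kmean \<kappa> h u $ j)))"

definition kprec :: "(real \<Rightarrow> real^'n \<Rightarrow> real^'n \<Rightarrow> real) \<Rightarrow> real \<Rightarrow> real^'n \<Rightarrow> real^'n^'n" where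
  "kprec \<kappa> h u = matrix_inv (kcov \<kappa> h u)"

definition Gnorm :: "real^'n^'n \<Rightarrow> real^'n \<Rightarrow> real" where
  "Gnorm G v = sqrt (v \<bullet> (G *v v))"

text \<open>H_h(Y0) = E[ int_{Y0} kappa(y;Y)^2 dy ], with P the law of Y^a.\<close>
definition Hh :: "(real^'n) measure \<Rightarrow> (real \<Rightarrow> real^'n \<Rightarrow> real^'n \<Rightarrow> real) \<Rightarrow> real \<Rightarrow> (real^'n) set \<Rightarrow> ennreal" where
  "Hh P \<kappa> h Y0 = (\<integral>\<^sup>+ u. (\<integral>\<^sup>+ y\<in>Y0. ennreal ((\<kappa> h y u)\<^sup>2) \<partial>lebesgue) \<partial>P)"

definition deff :: "(real^'n) measure \<Rightarrow> (real \<Rightarrow> real^'n \<Rightarrow> real^'n \<Rightarrow> real) \<Rightarrow> real \<Rightarrow> (real^'n) set \<Rightarrow> real" where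
  "deff P \<kappa> h Y0 = ln (max (enn2real (Hh P \<kappa> h Y0)) 1) / ln (1 / h)"

definition eigenvalues_are :: "real^'n^'n \<Rightarrow> (nat \<Rightarrow> real) \<Rightarrow> bool" where
  "eigenvalues_are A lam \<longleftrightarrow> (\<forall>x. det (mat x - A) = (\<Prod>j=1..CARD('n). x - lam j))"

end

theory Submission
  imports Defs
begin

text \<open>
  The inverse of the positive definite \<open>\<Sigma>\<close> factors as \<open>G = B B\<^sup>T\<close> (Gram--Schmidt for the form
  of \<open>\<Sigma>\<close>), so the substitution \<open>z = B\<^sup>T (y - m)\<close> reduces the integral of the squared Gaussian
  bound to a product of one-dimensional ones: the inner integral is at most
  \<open>C (det G)\<^bsup>1/2\<^esup>\<close>. Taking expectations and logarithms gives (a). In (b), the characteristic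
  polynomial at \<open>0\<close> yields \<open>det \<Sigma> = \<Prod>\<lambda>\<^sub>j\<close>, hence \<open>(det G)\<^bsup>1/2\<^esup>\<close> is of exact order \<open>h\<^bsup>-d\<^esup>\<close>,
  \<open>d\<close> the number of small eigenvalues; the upper bounds are then a case of (a), and the lower bound
  on the energy is integrated directly.
\<close>

subsection \<open>Linear algebra and Gaussian integrals\<close>

lemma matrix_inv_inverse:
  fixes A :: "real^'n^'n"
  assumes "invertible A"
  shows "A ** matrix_inv A = mat 1" and "matrix_inv A ** A = mat 1"
  using someI_ex[OF assms[unfolded invertible_def]] by (auto simp: matrix_inv_def)

lemma det_matrix_inv:
  fixes A :: "real^'n^'n"
  assumes "invertible A"
  shows "det (matrix_inv A) = 1 / det A"
proof -
  have "det A * det (matrix_inv A) = 1"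
    using arg_cong[OF matrix_inv_inverse(1)[OF assms], of det] by (simp add: det_mul)
  moreover have "det A \<noteq> 0" using assms by (simp add: invertible_det_nz)
  ultimately show ?thesis by (simp add: field_simps)
qed

text \<open>Gram-Schmidt for the form x . Ay: a set of k vectors orthonormal for it, with k below
  the dimension, does not span, so a vector outside its span yields one more. The columns of
  \<open>B\<close> are a full such set.\<close>

lemma posdef_congruent_identity:
  fixes A :: "real^'n^'n"
  assumes sym: "\<And>x y. x \<bullet> (A *v y) = y \<bullet> (A *v x)"
    and pos: "\<And>x. x \<noteq> 0 \<Longrightarrow> 0 < x \<bullet> (A *v x)"
  obtains B :: "real^'n^'n" where "transpose B ** A ** B = mat 1"
proof -
  have ex: "\<exists>S. finite S \<and> card S = k \<and> (\<forall>s\<in>S. \<forall>t\<in>S. s \<bullet> (A *v t) = (if s = t then 1 else 0))"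
    if "k \<le> CARD('n)" for k
    using that
  proof (induction k)
    case 0
    show ?case by (rule exI[of _ "{}"]) auto
  next
    case (Suc k)
    then obtain S where S: "finite S" "card S = k"
      and orth: "\<And>s t. s \<in> S \<Longrightarrow> t \<in> S \<Longrightarrow> s \<bullet> (A *v t) = (if s = t then 1 else 0)"
      by auto
    have "dim (span S) < CARD('n)"
      using dim_le_card'[of S] S Suc.prems by simp
    then have "span S \<noteq> UNIV"
      using dim_UNIV[where 'a="real^'n"] by force
    then obtain v where v: "v \<notin> span S" by auto
    \<comment> \<open>\<open>w\<close> is \<open>v\<close> minus its A-orthogonal projection onto
      \<open>span S\<close>. It is nonzero because \<open>v\<close> lies outside the span, so
      positivity of the form permits normalization.\<close>
    define w where "w = v - (\<Sum>s\<in>S. (v \<bullet> (A *v s)) *\<^sub>R s)"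
    have "w \<noteq> 0"
    proof
      assume "w = 0"
      then have "v = (\<Sum>s\<in>S. (v \<bullet> (A *v s)) *\<^sub>R s)" by (simp add: w_def)
      also have "\<dots> \<in> span S" by (intro span_sum span_scale span_base)
      finally show False using v by simp
    qed
    then have wpos: "0 < w \<bullet> (A *v w)" by (rule pos)
    have w_orth: "w \<bullet> (A *v t) = 0" if "t \<in> S" for t
    proof -
      have "w \<bullet> (A *v t) = v \<bullet> (A *v t) - (\<Sum>s\<in>S. (v \<bullet> (A *v s)) * (s \<bullet> (A *v t)))"
        by (simp add: w_def inner_diff_left inner_sum_left)
      also have "(\<Sum>s\<in>S. (v \<bullet> (A *v s)) * (s \<bullet> (A *v t))) = (\<Sum>s\<in>S. if s = t then v \<bullet> (A *v s) else 0)"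
        by (intro sum.cong refl) (auto simp: orth that)
      finally show ?thesis using S that by simp
    qed
    define e where "e = (1 / sqrt (w \<bullet> (A *v w))) *\<^sub>R w"
    have e1: "e \<bullet> (A *v e) = 1"
      using wpos by (simp add: e_def scaleR_matrix_vector_assoc[symmetric] matrix_vector_mult_scaleR)
    have e2: "e \<bullet> (A *v t) = 0" if "t \<in> S" for t
      by (simp add: e_def w_orth that)
    have e3: "t \<bullet> (A *v e) = 0" if "t \<in> S" for t
      using e2[OF that] sym by metis
    have "e \<notin> S" using e1 e2 by force
    then show ?case
      using S orth e1 e2 e3 by (intro exI[of _ "insert e S"]) auto
  qed
  from ex[of "CARD('n)"] obtain S where S: "finite S" "card S = CARD('n)"
      and orth: "\<And>s t. s \<in> S \<Longrightarrow> t \<in> S \<Longrightarrow> s \<bullet> (A *v t) = (if s = t then 1 else 0)"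
    by auto
  obtain f where f: "bij_betw f (UNIV :: 'n set) S"
    using finite_same_card_bij[of "UNIV :: 'n set" S] S by auto
  \<comment> \<open>The columns of \<open>B\<close> are the elements of \<open>S\<close>, so entry
    (i,j) of B^T A B is the form evaluated at \<open>f i\<close> and \<open>f j\<close>.\<close>
  define B :: "real^'n^'n" where "B = (\<chi> i j. f j $ i)"
  have "(transpose B ** A ** B) $ i $ j = f i \<bullet> (A *v f j)" for i j
    unfolding matrix_mul_assoc[symmetric]
    by (simp add: matrix_matrix_mult_def transpose_def B_def inner_vec_def matrix_vector_mult_def)
  moreover have "f i \<in> S" "f i = f j \<longleftrightarrow> i = j" for i j
    using f by (auto simp: bij_betw_def inj_on_eq_iff)
  ultimately have "transpose B ** A ** B = mat 1"
    by (simp add: vec_eq_iff orth mat_def)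
  then show ?thesis by (rule that)
qed

section \<open>Linear change of variables for Lebesgue measure\<close>

text \<open>\<open>measure_linear_image\<close> of HOL-Analysis has the same content, but only for well-ordered index types.\<close>

lemma measure_matrix_image:
  fixes A :: "real^'n^'n"
  assumes "det A \<noteq> 0" and "S \<in> lmeasurable"
  shows "((*v) A) ` S \<in> lmeasurable \<and> measure lebesgue (((*v) A) ` S) = \<bar>det A\<bar> * measure lebesgue S"
proof -
  \<comment> \<open>\<open>R\<close> is the property carried through the induction over elementary
    matrices. The guard makes singular factors harmless, and quantifying over all measurable sets
    lets a product \<open>A ** B\<close> apply \<open>R A\<close> to the image of S under
    \<open>B\<close>.\<close>
  define R where "R = (\<lambda>A::real^'n^'n. det A \<noteq> 0 \<longrightarrow> (\<forall>S\<in>lmeasurable. ((*v) A) ` S \<in> lmeasurable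
      \<and> measure lebesgue (((*v) A) ` S) = \<bar>det A\<bar> * measure lebesgue S))"
  \<comment> \<open>For a linear map, scaling of the volume of boxes extends to all measurable sets
    of finite measure, and empty boxes are trivial.\<close>
  have boxes: "R A" if "\<And>a b. cbox a b \<noteq> {} \<Longrightarrow>
      measure lebesgue (((*v) A) ` cbox a b) = \<bar>det A\<bar> * measure lebesgue (cbox a b)" for A
    unfolding R_def
    using measure_linear_sufficient[OF matrix_vector_mul_linear[of A], where m = "\<bar>det A\<bar>"] that
    by (metis image_empty measure_empty mult_zero_right)
  have "R A"
  proof (rule induct_matrix_elementary_alt)
    show "R (A ** B)" if "R A" "R B" for A B
    proof -
      have "((*v) (A ** B)) ` S = ((*v) A) ` (((*v) B) ` S)" for S
        by (simp add: image_comp o_def matrix_vector_mul_assoc)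
      then show ?thesis using that unfolding R_def by (auto simp: det_mul abs_mult)
    qed
    show "R A" if "row i A = 0" for A i
      using det_zero_row(2)[OF that] by (simp add: R_def)
    show "R A" if "\<And>i j. i \<noteq> j \<Longrightarrow> A$i$j = 0" for A
    proof -
      have "(*v) A = (\<lambda>x. \<chi> i. A$i$i * x$i)"
      proof (intro ext, subst vec_eq_iff, intro allI)
        fix x i
        have "(A *v x) $ i = (\<Sum>j\<in>UNIV. if j = i then A$i$i * x$i else 0)"
          unfolding matrix_vector_mult_def vec_lambda_beta using that by (intro sum.cong) auto
        then show "(A *v x) $ i = (\<chi> i. A$i$i * x$i) $ i" by simp
      qed
      moreover have "det A = (\<Prod>i\<in>UNIV. A$i$i)" using that by (rule det_diagonal)
      ultimately show ?thesis
        unfolding R_def by (simp add: measurable_stretch measure_stretch)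
    qed
    \<comment> \<open>A swap of two coordinates maps a box to the box with swapped corners, whose
      side lengths are the same up to order. The determinant is -1, and the absolute value removes
      the sign.\<close>
    show "R (\<chi> i j. mat 1 $ i $ Transposition.transpose m n j)" if "m \<noteq> n" for m n
    proof (rule boxes)
      let ?A = "\<chi> i j. mat 1 $ i $ Transposition.transpose m n j :: real^'n^'n"
      let ?t = "Transposition.transpose m n"
      fix a b :: "real^'n" assume ne: "cbox a b \<noteq> {}"
      have A: "?A *v x = (\<chi> i. x $ ?t i)" for x
      proof (subst vec_eq_iff, intro allI)
        fix i
        have "(?A *v x) $ i = (\<Sum>j\<in>UNIV. if j = ?t i then x $ j else 0)"
          unfolding matrix_vector_mult_def mat_def vec_lambda_beta
          by (intro sum.cong) (auto simp: transpose_eq_iff)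
        then show "(?A *v x) $ i = (\<chi> i. x $ ?t i) $ i" by simp
      qed
      have inv: "?A *v (?A *v x) = x" for x by (simp add: A vec_eq_iff)
      \<comment> \<open>This inclusion holds for every box, and the swap is an involution, so
        applying it to the swapped corners gives the reverse inclusion.\<close>
      have sub: "((*v) ?A) ` cbox a b \<subseteq> cbox (?A *v a) (?A *v b)" for a b
        by (auto simp: A mem_box_cart)
      then have eq: "((*v) ?A) ` cbox a b = cbox (?A *v a) (?A *v b)"
      proof (intro equalityI subsetI)
        fix y assume "y \<in> cbox (?A *v a) (?A *v b)"
        with sub[of "?A *v a" "?A *v b"] have "?A *v y \<in> cbox a b" by (auto simp: inv)
        then show "y \<in> ((*v) ?A) ` cbox a b" by (rule rev_image_eqI) (simp only: inv)
      qed auto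
      have "measure lebesgue (((*v) ?A) ` cbox a b) = (\<Prod>i\<in>UNIV. b $ ?t i - a $ ?t i)"
      proof -
        have "cbox (?A *v a) (?A *v b) \<noteq> {}" using ne eq[symmetric] by simp
        then show ?thesis unfolding eq by (simp add: content_cbox_cart A)
      qed
      also have "\<dots> = (\<Prod>i\<in>UNIV. b $ i - a $ i)"
        by (rule prod.reindex_bij_betw) (simp add: bij_transpose)
      also have "\<dots> = measure lebesgue (cbox a b)"
        using ne by (simp add: content_cbox_cart)
      finally show "measure lebesgue (((*v) ?A) ` cbox a b) = \<bar>det ?A\<bar> * measure lebesgue (cbox a b)"
        using that by (simp add: det_permute_columns permutes_swap_id sign_swap_id)
    qed
    show "R (\<chi> i j. of_bool (i = m \<and> j = n \<or> i = j))" if "m \<noteq> n" for m n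
    proof (rule boxes)
      let ?A = "\<chi> i j. of_bool (i = m \<and> j = n \<or> i = j) :: real^'n^'n"
      fix a b :: "real^'n" assume ne: "cbox a b \<noteq> {}"
      have A: "(*v) ?A = (\<lambda>x. \<chi> i. if i = m then x$m + x$n else x$i)"
      proof (intro ext, subst vec_eq_iff, intro allI)
        fix x i
        have "(?A *v x) $ i = (\<Sum>j\<in>UNIV. (if j = i then x $ j else 0) + (if i = m \<and> j = n then x $ j else 0))"
          unfolding matrix_vector_mult_def vec_lambda_beta using that by (intro sum.cong) auto
        then show "(?A *v x) $ i = (\<chi> i. if i = m then x$m + x$n else x$i) $ i"
          by (auto simp: sum.distrib)
      qed
      have "?A = (\<chi> k. if k = m then row m (mat 1) + 1 *s row n (mat 1) else row k (mat 1))"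
        using that by (auto simp: vec_eq_iff row_def mat_def)
      then have det: "det ?A = 1"
        using det_row_operation[OF that, of "mat 1 :: real^'n^'n" 1] by simp
      \<comment> \<open>Translation moves the lower corner to the origin, so that the shear formula
        for boxes with a nonnegative lower coordinate applies. Volume is invariant under the
        translation before and after the shear.\<close>
      have box: "cbox a b = (+) a ` cbox 0 (b - a)"
        using cbox_translation[of a 0 "b - a"] by simp
      have "((*v) ?A) ` cbox a b = (+) (?A *v a) ` ((*v) ?A) ` cbox 0 (b - a)"
        unfolding box by (simp only: image_comp o_def matrix_vector_right_distrib)
      then have "measure lebesgue (((*v) ?A) ` cbox a b) = measure lebesgue (((*v) ?A) ` cbox 0 (b - a))"
        by (simp add: measure_translation)
      also have "\<dots> = measure lebesgue (cbox 0 (b - a))"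
        unfolding A using that ne box by (intro measure_shear_interval) auto
      also have "\<dots> = measure lebesgue (cbox a b)"
        unfolding box by (simp only: measure_translation)
      finally show "measure lebesgue (((*v) ?A) ` cbox a b) = \<bar>det ?A\<bar> * measure lebesgue (cbox a b)"
        by (simp only: det abs_one mult_1)
    qed
  qed
  then show ?thesis using assms by (simp add: R_def)
qed

text \<open>The identity is proved for measures: the image of \<open>lborel\<close> under
  \<open>B\<close>, scaled by |det B|, gives every box its volume and hence is
  \<open>lborel\<close>. Integrating \<open>g\<close> against both sides gives the formula.\<close>

lemma nn_integral_lborel_matrix_mult:
  fixes B :: "real^'n^'n"
  assumes det: "det B \<noteq> 0" and g: "g \<in> borel_measurable borel"
  shows "ennreal \<bar>det B\<bar> * (\<integral>\<^sup>+x. g (B *v x) \<partial>lborel) = (\<integral>\<^sup>+x. g x \<partial>lborel)"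
proof -
  let ?f = "\<lambda>x. B *v x" and ?g = "\<lambda>x. matrix_inv B *v x"
  have m[measurable]: "?f \<in> borel_measurable borel"
    by (intro borel_measurable_continuous_onI linear_continuous_on
          linear_conv_bounded_linear[THEN iffD1] matrix_vector_mul_linear)
  have inv: "invertible B" using det by (simp add: invertible_det_nz)
  have di: "\<bar>det B\<bar> * \<bar>det (matrix_inv B)\<bar> = 1"
    using det by (simp add: det_matrix_inv[OF inv])
  \<comment> \<open>A preimage under \<open>B\<close> is an image under its inverse, which turns the
    volume formula for images into one for the pushforward.\<close>
  have vim: "?f -` X = ?g ` X" for X
  proof -
    have "?f (?g x) = x" "?g (?f x) = x" for x
      by (simp_all add: matrix_vector_mul_assoc matrix_inv_inverse[OF inv])
    then show ?thesis by (intro set_eqI) (metis image_iff vimage_eq)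
  qed
  have em: "emeasure lborel (?f -` box l u) = ennreal (\<bar>det (matrix_inv B)\<bar> * measure lborel (box l u))" for l u
  proof -
    have b: "?f -` box l u \<in> sets borel"
      using measurable_sets[OF m, of "box l u"] by simp
    have img: "?g ` box l u \<in> lmeasurable"
        "measure lebesgue (?g ` box l u) = \<bar>det (matrix_inv B)\<bar> * measure lborel (box l u)"
      using measure_matrix_image[of "matrix_inv B" "box l u"] det det_matrix_inv[OF inv] by auto
    have "emeasure lborel (?f -` box l u) = emeasure lebesgue (?g ` box l u)"
      using b by (simp add: vim)
    also have "\<dots> = ennreal (measure lebesgue (?g ` box l u))"
      using img by (simp add: emeasure_eq_measure2)
    finally show ?thesis by (simp add: img)
  qed
  have "lborel = density (distr lborel borel ?f) (\<lambda>_. ennreal \<bar>det B\<bar>)"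
  proof (rule lborel_eqI)
    fix l u :: "real^'n"
    assume lu: "\<And>b. b \<in> Basis \<Longrightarrow> l \<bullet> b \<le> u \<bullet> b"
    have "emeasure (density (distr lborel borel ?f) (\<lambda>_. ennreal \<bar>det B\<bar>)) (box l u)
        = ennreal \<bar>det B\<bar> * emeasure lborel (?f -` box l u)"
      by (simp add: emeasure_density_const emeasure_distr)
    also have "\<dots> = ennreal ((\<bar>det B\<bar> * \<bar>det (matrix_inv B)\<bar>) * measure lborel (box l u))"
      by (simp add: em ennreal_mult'[symmetric] mult.assoc)
    also have "\<dots> = ennreal (measure lborel (box l u))"
      by (simp only: di mult_1)
    also have "\<dots> = (\<Prod>b\<in>Basis. (u - l) \<bullet> b)"
      using lu by (simp add: measure_def prod_nonneg inner_diff_left)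
    finally show "emeasure (density (distr lborel borel ?f) (\<lambda>_. ennreal \<bar>det B\<bar>)) (box l u)
        = (\<Prod>b\<in>Basis. (u - l) \<bullet> b)" .
  qed simp
  then have "(\<integral>\<^sup>+x. g x \<partial>lborel) = (\<integral>\<^sup>+x. g x \<partial>density (distr lborel borel ?f) (\<lambda>_. ennreal \<bar>det B\<bar>))"
    by simp
  also have "\<dots> = ennreal \<bar>det B\<bar> * (\<integral>\<^sup>+x. g (B *v x) \<partial>lborel)"
    using g by (simp add: nn_integral_density nn_integral_distr nn_integral_cmult)
  finally show ?thesis by simp
qed

section \<open>Isotropic Gaussian integrals\<close>

lemma nn_integral_exp_neg_square:
  assumes a: "0 < a"
  shows "(\<integral>\<^sup>+(x::real). ennreal (exp (- a * x\<^sup>2)) \<partial>lborel) = ennreal (sqrt (pi / a))"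
proof -
  \<comment> \<open>The normal density with variance 1/(2a) has exponent -a x^2 and normalizing
    factor 1/sqrt(pi/a), so its total mass 1 gives the integral.\<close>
  define s where "s = sqrt (1 / (2 * a))"
  have s: "s > 0" "s\<^sup>2 = 1 / (2 * a)" using a by (auto simp: s_def)
  have "exp (- a * x\<^sup>2) = sqrt (pi / a) * normal_density 0 s x" for x
  proof -
    have "- (x - 0)\<^sup>2 / (2 * s\<^sup>2) = - a * x\<^sup>2" "2 * pi * s\<^sup>2 = pi / a"
      unfolding s(2) using a by (simp_all add: field_simps)
    then show ?thesis using a by (simp add: normal_density_def)
  qed
  then have "(\<integral>\<^sup>+(x::real). ennreal (exp (- a * x\<^sup>2)) \<partial>lborel)
      = ennreal (sqrt (pi / a)) * (\<integral>\<^sup>+x. ennreal (normal_density 0 s x) \<partial>lborel)"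
    using a by (simp add: ennreal_mult nn_integral_cmult)
  also have "(\<integral>\<^sup>+x. ennreal (normal_density 0 s x) \<partial>lborel) = 1"
    using s(1) by (subst nn_integral_eq_integral) auto
  finally show ?thesis by simp
qed

text \<open>The squared norm is a sum over coordinates, so the exponential factors and the integral
  is a power of the one-dimensional one.\<close>

lemma nn_integral_exp_neg_norm_square:
  assumes a: "0 < a"
  shows "(\<integral>\<^sup>+(x::'a::euclidean_space). ennreal (exp (- a * (norm x)\<^sup>2)) \<partial>lborel)
           = ennreal ((pi / a) powr (real DIM('a) / 2))"
proof -
  have "exp (- a * (norm x)\<^sup>2) = (\<Prod>b\<in>Basis. exp (- a * (x \<bullet> b)\<^sup>2))" for x :: 'a
  proof -
    have "(norm x)\<^sup>2 = (\<Sum>b\<in>Basis. (x \<bullet> b)\<^sup>2)"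
      by (subst power2_norm_eq_inner, subst euclidean_inner) (simp add: power2_eq_square)
    then show ?thesis by (simp add: sum_distrib_left exp_sum flip: sum_negf)
  qed
  then have "(\<integral>\<^sup>+(x::'a). ennreal (exp (- a * (norm x)\<^sup>2)) \<partial>lborel)
      = (\<integral>\<^sup>+(x::'a). (\<Prod>b\<in>Basis. ennreal (exp (- a * (x \<bullet> b)\<^sup>2))) \<partial>lborel)"
    by (simp add: prod_ennreal)
  also have "\<dots> = (\<Prod>b\<in>(Basis::'a set). ennreal (sqrt (pi / a)))"
    by (subst nn_integral_lborel_prod) (auto simp: nn_integral_exp_neg_square[OF a, simplified])
  also have "\<dots> = ennreal (sqrt (pi / a) ^ DIM('a))"
    using a by (simp add: ennreal_power)
  also have "sqrt (pi / a) ^ DIM('a) = (pi / a) powr (real DIM('a) / 2)"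
    using a by (simp add: powr_half_sqrt[symmetric] powr_realpow[symmetric] powr_powr)
  finally show ?thesis .
qed

section \<open>Positive definite matrices and anisotropic Gaussian integrals\<close>

text \<open>If the form vanished at x, moving from x along -Ax would make it negative: the linear
  term in t is -2t |Ax|^2, and Ax is nonzero by invertibility.\<close>

lemma psd_invertible_imp_posdef:
  fixes A :: "real^'n^'n"
  assumes sym: "\<And>x y. x \<bullet> (A *v y) = y \<bullet> (A *v x)"
    and psd: "\<And>x. 0 \<le> x \<bullet> (A *v x)"
    and inv: "invertible A" and x: "x \<noteq> 0"
  shows "0 < x \<bullet> (A *v x)"
proof (rule ccontr)
  assume "\<not> ?thesis"
  with psd[of x] have x0: "x \<bullet> (A *v x) = 0" by simp
  let ?z = "A *v x"
  let ?q = "?z \<bullet> (A *v ?z)"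
  have "A *v x \<noteq> 0"
  proof
    assume "A *v x = 0"
    then have "(matrix_inv A ** A) *v x = 0"
      by (simp flip: matrix_vector_mul_assoc)
    then show False using x by (simp add: matrix_inv_inverse[OF inv])
  qed
  then have z: "0 < ?z \<bullet> ?z" by simp
  have quad: "0 \<le> t\<^sup>2 * ?q - 2 * t * (?z \<bullet> ?z)" for t
  proof -
    have "(x - t *\<^sub>R ?z) \<bullet> (A *v (x - t *\<^sub>R ?z))
      = x \<bullet> (A *v x) - t * (x \<bullet> (A *v ?z)) - t * (?z \<bullet> (A *v x)) + t\<^sup>2 * ?q"
      by (simp add: matrix_vector_mult_diff_distrib matrix_vector_mult_scaleR inner_diff_left
          inner_diff_right power2_eq_square algebra_simps)
    also have "x \<bullet> (A *v ?z) = ?z \<bullet> ?z" using sym[of x ?z] by simp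
    finally show ?thesis using psd[of "x - t *\<^sub>R ?z"] x0 by simp
  qed
  \<comment> \<open>The choice t = 1 shows that the quadratic coefficient is positive. The next
    choice of t is then the minimizer of the parabola, where its value is -|z|^4 / q < 0.\<close>
  have q: "?q > 0" using quad[of 1] z by (simp del: inner_gt_zero_iff)
  from quad[of "(?z \<bullet> ?z) / ?q"] q have "0 \<le> - ((?z \<bullet> ?z)\<^sup>2 / ?q)"
    by (simp add: power2_eq_square field_simps)
  moreover have "(?z \<bullet> ?z)\<^sup>2 / ?q > 0" using q z by simp
  ultimately show False by simp
qed

lemma posdef_matrix_inv_factor:
  fixes A :: "real^'n^'n"
  assumes sym: "\<And>x y. x \<bullet> (A *v y) = y \<bullet> (A *v x)"
    and pos: "\<And>x. x \<noteq> 0 \<Longrightarrow> 0 < x \<bullet> (A *v x)"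
  obtains B :: "real^'n^'n" where "det B \<noteq> 0" "matrix_inv A = B ** transpose B"
proof -
  obtain B :: "real^'n^'n" where B: "transpose B ** A ** B = mat 1"
    using posdef_congruent_identity[OF sym pos] by blast
  have "det B * det A * det B = 1"
    using arg_cong[OF B, of det] by (simp add: det_mul det_transpose)
  then have nz: "det B \<noteq> 0" "det A \<noteq> 0" by auto
  have "transpose B ** (A ** B) = mat 1" using B by (simp add: matrix_mul_assoc)
  \<comment> \<open>For square matrices a left inverse is also a right inverse. Here B^T is the
    inverse of AB, which moves it to the other side.\<close>
  then have "(A ** B) ** transpose B = mat 1" by (simp add: matrix_left_right_inverse)
  then have AB: "A ** (B ** transpose B) = mat 1" by (simp add: matrix_mul_assoc)
  have inv: "invertible A" using nz by (simp add: invertible_det_nz)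
  have "matrix_inv A = matrix_inv A ** (A ** (B ** transpose B))" by (simp add: AB)
  also have "\<dots> = B ** transpose B" by (simp add: matrix_mul_assoc matrix_inv_inverse[OF inv])
  finally show ?thesis using nz that by blast
qed

text \<open>With G = B B^T, the G-norm of v is |B^T v| and the root of det G is |det B|. The
  prefactor is therefore exactly the Jacobian of z = B^T (y - m), and an isotropic integral
  independent of G remains.\<close>

lemma nn_integral_exp_neg_Gnorm:
  fixes A :: "real^'n^'n"
  assumes sym: "\<And>x y. x \<bullet> (A *v y) = y \<bullet> (A *v x)"
    and pos: "\<And>x. x \<noteq> 0 \<Longrightarrow> 0 < x \<bullet> (A *v x)"
    and a: "0 < a"
  shows "det (matrix_inv A) > 0"
    and "ennreal (sqrt (det (matrix_inv A))) *
           (\<integral>\<^sup>+y. ennreal (exp (- a * (Gnorm (matrix_inv A) (y - m))\<^sup>2)) \<partial>lborel)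
         = ennreal ((pi / a) powr (real CARD('n) / 2))"
proof -
  obtain B :: "real^'n^'n" where B: "det B \<noteq> 0" "matrix_inv A = B ** transpose B"
    using posdef_matrix_inv_factor[OF sym pos] by blast
  have d: "det (matrix_inv A) = (det B)\<^sup>2"
    by (simp add: B det_mul det_transpose power2_eq_square)
  then show "det (matrix_inv A) > 0" using B by simp
  have G: "(Gnorm (matrix_inv A) v)\<^sup>2 = (norm (transpose B *v v))\<^sup>2" for v
  proof -
    have "v \<bullet> (matrix_inv A *v v) = (transpose B *v v) \<bullet> (transpose B *v v)"
      by (simp add: B dot_lmul_matrix flip: matrix_vector_mul_assoc)
    then show ?thesis by (simp add: Gnorm_def power2_norm_eq_inner)
  qed
  define g where "g = (\<lambda>x::real^'n. ennreal (exp (- a * (norm x)\<^sup>2)))"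
  have g[measurable]: "g \<in> borel_measurable borel" unfolding g_def by measurable
  have m2[measurable]: "(\<lambda>x. transpose B *v x) \<in> borel_measurable borel"
    by (intro borel_measurable_continuous_onI linear_continuous_on
          linear_conv_bounded_linear[THEN iffD1] matrix_vector_mul_linear)
  have "(\<integral>\<^sup>+y. ennreal (exp (- a * (Gnorm (matrix_inv A) (y - m))\<^sup>2)) \<partial>lborel)
      = (\<integral>\<^sup>+y. g (transpose B *v (- m + y)) \<partial>lborel)"
    unfolding G g_def by simp
  also have "\<dots> = (\<integral>\<^sup>+y. g (transpose B *v y) \<partial>distr lborel borel ((+) (- m)))"
    by (subst nn_integral_distr) measurable
  also have "\<dots> = (\<integral>\<^sup>+y. g (transpose B *v y) \<partial>lborel)"
    by (simp only: lborel_distr_plus)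
  finally have "ennreal (sqrt (det (matrix_inv A))) *
           (\<integral>\<^sup>+y. ennreal (exp (- a * (Gnorm (matrix_inv A) (y - m))\<^sup>2)) \<partial>lborel)
     = ennreal \<bar>det (transpose B)\<bar> * (\<integral>\<^sup>+y. g (transpose B *v y) \<partial>lborel)"
    by (simp add: d det_transpose)
  also have "\<dots> = (\<integral>\<^sup>+y. g y \<partial>lborel)"
    using B by (intro nn_integral_lborel_matrix_mult) (auto simp: det_transpose)
  also have "\<dots> = ennreal ((pi / a) powr (real CARD('n) / 2))"
    unfolding g_def by (subst nn_integral_exp_neg_norm_square[OF a]) simp
  finally show "ennreal (sqrt (det (matrix_inv A))) *
           (\<integral>\<^sup>+y. ennreal (exp (- a * (Gnorm (matrix_inv A) (y - m))\<^sup>2)) \<partial>lborel)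
         = ennreal ((pi / a) powr (real CARD('n) / 2))" .
qed

section \<open>Measurability of determinants and inverses\<close>

lemma borel_measurable_det:
  fixes A :: "'a \<Rightarrow> real^'n^'n"
  assumes [measurable]: "\<And>i j. (\<lambda>x. A x $ i $ j) \<in> borel_measurable M"
  shows "(\<lambda>x. det (A x)) \<in> borel_measurable M"
  unfolding det_def by measurable

text \<open>By Cramer's rule each entry of the inverse is a quotient of determinants, thus a
  rational function of the entries of the matrix.\<close>

lemma borel_measurable_matrix_inv_nth:
  fixes A :: "'a \<Rightarrow> real^'n^'n"
  assumes A[measurable]: "\<And>i j. (\<lambda>x. A x $ i $ j) \<in> borel_measurable M"
    and inv: "\<And>x. x \<in> space M \<Longrightarrow> invertible (A x)"
  shows "(\<lambda>x. matrix_inv (A x) $ i $ j) \<in> borel_measurable M"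
proof -
  \<comment> \<open>\<open>N x\<close> is \<open>A x\<close> with column \<open>i\<close> replaced
    by the \<open>j\<close>-th unit vector, the numerator in Cramer's rule for column
    \<open>j\<close> of the inverse.\<close>
  define N where "N x = (\<chi> k l. if l = i then axis j 1 $ k else A x $ k $ l)" for x
  have "matrix_inv (A x) $ i $ j = det (N x) / det (A x)" if "x \<in> space M" for x
  proof -
    have "A x *v (matrix_inv (A x) *v axis j 1) = axis j 1"
      by (simp add: matrix_vector_mul_assoc matrix_inv_inverse[OF inv[OF that]])
    moreover have "det (A x) \<noteq> 0" using inv[OF that] by (simp add: invertible_det_nz)
    ultimately have "matrix_inv (A x) *v axis j 1
        = (\<chi> k. det (\<chi> i l. if l = k then axis j 1 $ i else A x $ i $ l) / det (A x))"
      using cramer by blast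
    then have "(matrix_inv (A x) *v axis j 1) $ i = det (N x) / det (A x)"
      by (simp add: N_def)
    then show ?thesis by (simp add: matrix_vector_mult_basis column_def)
  qed
  moreover have "(\<lambda>x. N x $ k $ l) \<in> borel_measurable M" for k l
    unfolding N_def by (cases "l = i") simp_all
  then have "(\<lambda>x. det (N x) / det (A x)) \<in> borel_measurable M"
    by (intro borel_measurable_divide borel_measurable_det A)
  ultimately show ?thesis by (simp cong: measurable_cong)
qed

lemma borel_measurable_vec_nth[measurable (raw)]:
  fixes f :: "'a \<Rightarrow> real^'n"
  shows "f \<in> borel_measurable M \<Longrightarrow> (\<lambda>x. f x $ i) \<in> borel_measurable M"
  by (rule measurable_compose[OF _ borel_measurable_nth])

subsection \<open>Moments of the kernel\<close>

lemma kcov_nth: "kcov \<kappa> h u $ i $ j =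
    (LINT v|lborel. \<kappa> h v u * ((v$i - kmean \<kappa> h u $ i) * (v$j - kmean \<kappa> h u $ j)))"
  by (simp add: kcov_def)

text \<open>Writing the form as the integral of a nonnegative integrand makes semidefiniteness
  visible. The finite sums pass through the integral once each covariance integrand is
  integrable.\<close>

lemma kcov_quadratic_form:
  fixes \<kappa> :: "real \<Rightarrow> real^'n \<Rightarrow> real^'n \<Rightarrow> real"
  assumes nn: "\<And>v. 0 \<le> \<kappa> h v u"
    and int0: "integrable lborel (\<lambda>v. \<kappa> h v u)"
    and int2: "integrable lborel (\<lambda>v. \<kappa> h v u * (norm v)\<^sup>2)"
  shows "x \<bullet> (kcov \<kappa> h u *v x) = (LINT v|lborel. \<kappa> h v u * ((v - kmean \<kappa> h u) \<bullet> x)\<^sup>2)"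
proof -
  let ?m = "kmean \<kappa> h u"
  have [measurable]: "(\<lambda>v. \<kappa> h v u) \<in> borel_measurable borel"
    using borel_measurable_integrable[OF int0] by simp
  have int: "integrable lborel (\<lambda>v. \<kappa> h v u * ((v$i - ?m$i) * (v$j - ?m$j)))" for i j
  proof (rule Bochner_Integration.integrable_bound)
    \<comment> \<open>The dominating function comes from (|v| + |m|)^2 <= 2|v|^2 + 2|m|^2.\<close>
    show "integrable lborel (\<lambda>v. 2 * (\<kappa> h v u * (norm v)\<^sup>2) + 2 * (norm ?m)\<^sup>2 * \<kappa> h v u)"
      using int0 int2 by auto
    show "(\<lambda>v. \<kappa> h v u * ((v$i - ?m$i) * (v$j - ?m$j))) \<in> borel_measurable lborel"
      by measurable
    have "norm (\<kappa> h v u * ((v$i - ?m$i) * (v$j - ?m$j)))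
        \<le> norm (2 * (\<kappa> h v u * (norm v)\<^sup>2) + 2 * (norm ?m)\<^sup>2 * \<kappa> h v u)" for v
    proof -
      have "\<bar>(v$i - ?m$i) * (v$j - ?m$j)\<bar> \<le> norm (v - ?m) * norm (v - ?m)"
        unfolding abs_mult
        using component_le_norm_cart[of "v - ?m" i] component_le_norm_cart[of "v - ?m" j]
        by (intro mult_mono) auto
      also have "\<dots> \<le> (norm v + norm ?m)\<^sup>2"
        using norm_triangle_ineq4[of v ?m] by (simp add: power2_eq_square mult_mono)
      also have "\<dots> \<le> 2 * (norm v)\<^sup>2 + 2 * (norm ?m)\<^sup>2"
        using sum_squares_bound[of "norm v" "norm ?m"] by (simp add: power2_sum)
      finally have "\<kappa> h v u * \<bar>(v$i - ?m$i) * (v$j - ?m$j)\<bar> \<le> \<kappa> h v u * (2 * (norm v)\<^sup>2 + 2 * (norm ?m)\<^sup>2)"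
        using nn by (intro mult_left_mono)
      then show ?thesis using nn[of v] by (simp add: abs_mult distrib_left mult.left_commute mult.commute)
    qed
    then show "AE v in lborel. norm (\<kappa> h v u * ((v$i - ?m$i) * (v$j - ?m$j)))
        \<le> norm (2 * (\<kappa> h v u * (norm v)\<^sup>2) + 2 * (norm ?m)\<^sup>2 * \<kappa> h v u)" by simp
  qed
  have "x \<bullet> (kcov \<kappa> h u *v x) = (\<Sum>i\<in>UNIV. \<Sum>j\<in>UNIV. x$i * x$j * kcov \<kappa> h u $ i $ j)"
    by (simp add: inner_vec_def matrix_vector_mult_def sum_distrib_left algebra_simps)
  also have "\<dots> = (LINT v|lborel. (\<Sum>i\<in>UNIV. \<Sum>j\<in>UNIV. x$i * x$j * (\<kappa> h v u * ((v$i - ?m$i) * (v$j - ?m$j)))))"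
    unfolding kcov_nth using int by simp
  also have "\<dots> = (LINT v|lborel. \<kappa> h v u * ((v - ?m) \<bullet> x)\<^sup>2)"
    by (intro Bochner_Integration.integral_cong refl)
       (simp add: inner_vec_def power2_eq_square sum_product sum_distrib_left algebra_simps)
  finally show ?thesis .
qed

lemma kcov_symmetric:
  "x \<bullet> (kcov \<kappa> h u *v y) = y \<bullet> (kcov \<kappa> h u *v x)"
proof -
  have "transpose (kcov \<kappa> h u) = kcov \<kappa> h u"
    by (simp add: vec_eq_iff transpose_def kcov_def mult.commute)
  then show ?thesis
    by (metis dot_lmul_matrix inner_commute transpose_matrix_vector)
qed

lemma kcov_posdef:
  fixes \<kappa> :: "real \<Rightarrow> real^'n \<Rightarrow> real^'n \<Rightarrow> real"
  assumes nn: "\<And>v. 0 \<le> \<kappa> h v u"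
    and int0: "integrable lborel (\<lambda>v. \<kappa> h v u)"
    and int2: "integrable lborel (\<lambda>v. \<kappa> h v u * (norm v)\<^sup>2)"
    and inv: "invertible (kcov \<kappa> h u)" and "x \<noteq> 0"
  shows "0 < x \<bullet> (kcov \<kappa> h u *v x)"
  using kcov_symmetric _ inv \<open>x \<noteq> 0\<close>
proof (rule psd_invertible_imp_posdef)
  show "0 \<le> z \<bullet> (kcov \<kappa> h u *v z)" for z
    unfolding kcov_quadratic_form[of \<kappa> h u, OF nn int0 int2] using nn by simp
qed

lemma borel_measurable_kmean_nth:
  fixes \<kappa> :: "real \<Rightarrow> real^'n \<Rightarrow> real^'n \<Rightarrow> real"
  assumes "(\<lambda>(v,u). \<kappa> h v u) \<in> borel_measurable borel"
  shows "(\<lambda>u. kmean \<kappa> h u $ i) \<in> borel_measurable borel"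
proof -
  have [measurable]: "(\<lambda>(v,u). \<kappa> h v u) \<in> borel_measurable (borel \<Otimes>\<^sub>M borel)"
    using assms by (simp add: borel_prod)
  show ?thesis unfolding kmean_def vec_lambda_beta by measurable
qed

lemma borel_measurable_kcov_nth:
  fixes \<kappa> :: "real \<Rightarrow> real^'n \<Rightarrow> real^'n \<Rightarrow> real"
  assumes "(\<lambda>(v,u). \<kappa> h v u) \<in> borel_measurable borel"
  shows "(\<lambda>u. kcov \<kappa> h u $ i $ j) \<in> borel_measurable borel"
proof -
  have [measurable]: "(\<lambda>(v,u). \<kappa> h v u) \<in> borel_measurable (borel \<Otimes>\<^sub>M borel)"
    using assms by (simp add: borel_prod)
  note [measurable] = borel_measurable_kmean_nth[of \<kappa> h, OF assms]
  show ?thesis unfolding kcov_nth by measurable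
qed

subsection \<open>Effective dimension\<close>

lemma Hh_mono: "Y \<subseteq> Z \<Longrightarrow> Hh P \<kappa> h Y \<le> Hh P \<kappa> h Z"
  unfolding Hh_def by (intro nn_integral_mono) (auto split: split_indicator)

lemma Hh_UNIV: "Hh P \<kappa> h UNIV = (\<integral>\<^sup>+u. (\<integral>\<^sup>+y. ennreal ((\<kappa> h y u)\<^sup>2) \<partial>lebesgue) \<partial>P)"
  by (simp add: Hh_def)

text \<open>The normalization by ln(1/h) reads off the exponent of a power of h and leaves the
  constant factor as an error of order 1/ln(1/h).\<close>

lemma ln_powr_times:
  assumes "0 < a" "0 < (h::real)" "h < 1"
  shows "ln (a * h powr (- r)) / ln (1 / h) = r + ln a / ln (1 / h)"
proof -
  have "ln (a * h powr (- r)) = ln a + r * ln (1 / h)"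
    using assms by (simp add: ln_mult ln_powr ln_div)
  then show ?thesis using assms by (simp add: add_divide_distrib)
qed

text \<open>Raising the constant to \<open>max a 1\<close> keeps the bound at least 1, since h < 1
  and r >= 0. It then also dominates the truncation at 1 inside \<open>deff\<close>.\<close>

lemma deff_le:
  assumes h: "0 < h" "h < 1" and r: "0 \<le> r"
    and H: "Hh P \<kappa> h Y \<le> ennreal (a * h powr (- r))"
  shows "deff P \<kappa> h Y \<le> r + ln (max a 1) / ln (1 / h)"
proof -
  have p: "1 \<le> h powr (- r)"
    using powr_mono'[of "- r" 0 h] h r by simp
  have "Hh P \<kappa> h Y \<le> ennreal (max a 1 * h powr (- r))"
    by (rule order_trans[OF H]) (auto intro!: ennreal_leI mult_right_mono)
  then have "enn2real (Hh P \<kappa> h Y) \<le> max a 1 * h powr (- r)"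
    by (intro enn2real_leI) auto
  moreover have "1 * 1 \<le> max a 1 * h powr (- r)"
    using p by (intro mult_mono) auto
  ultimately have "ln (max (enn2real (Hh P \<kappa> h Y)) 1) \<le> ln (max a 1 * h powr (- r))"
    by (subst ln_le_cancel_iff) (auto intro: less_le_trans[OF zero_less_one])
  then have "deff P \<kappa> h Y \<le> ln (max a 1 * h powr (- r)) / ln (1 / h)"
    unfolding deff_def using h by (intro divide_right_mono) auto
  then show ?thesis using h by (simp only: ln_powr_times[of "max a 1"])
qed

text \<open>Finiteness of the energy matters here: \<open>enn2real\<close> sends infinity to 0,
  which would destroy the lower bound.\<close>

lemma deff_ge:
  assumes h: "0 < h" "h < 1" and b: "0 < b"
    and H: "ennreal (b * h powr (- r)) \<le> Hh P \<kappa> h Y" "Hh P \<kappa> h Y < \<infinity>"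
  shows "r + ln b / ln (1 / h) \<le> deff P \<kappa> h Y"
proof -
  have "b * h powr (- r) \<le> enn2real (Hh P \<kappa> h Y)"
    using enn2real_mono[OF H(1)] H(2) b by simp
  then have "ln (b * h powr (- r)) \<le> ln (max (enn2real (Hh P \<kappa> h Y)) 1)"
    using b h by (subst ln_le_cancel_iff) auto
  then have "ln (b * h powr (- r)) / ln (1 / h) \<le> deff P \<kappa> h Y"
    unfolding deff_def using h by (intro divide_right_mono) auto
  then show ?thesis using ln_powr_times[OF b h] by simp
qed

lemma tendsto_const_over_ln_inverse: "((\<lambda>h. c / ln (1 / h)) \<longlongrightarrow> 0) (at_right (0::real))"
proof -
  have "((\<lambda>h. (- c) / ln h) \<longlongrightarrow> 0) (at_right (0::real))"
    by (intro tendsto_divide_0[OF tendsto_const] filterlim_at_bot_imp_at_infinity ln_at_0)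
  moreover have "\<forall>\<^sub>F h in at_right (0::real). (- c) / ln h = c / ln (1 / h)"
    using eventually_at_right_less[of "0::real"] by eventually_elim (simp add: ln_div)
  ultimately show ?thesis by (rule Lim_transform_eventually)
qed

section \<open>Determinants of matrices with a two-scale spectrum\<close>

lemma det_eigenvalues:
  assumes "eigenvalues_are A lam"
  shows "det (A :: real^'n^'n) = (\<Prod>j=1..CARD('n). lam j)"
proof -
  have "det (mat 0 - A) = (\<Prod>j=1..CARD('n). 0 - lam j)"
    using assms unfolding eigenvalues_are_def by blast
  \<comment> \<open>Negation is written as scaling every row by -1, so multilinearity produces the
    sign (-1)^n that cancels against the one from the product.\<close>
  moreover have "mat 0 - A = (\<chi> i. (- 1) *s A $ i)" by (simp add: vec_eq_iff mat_def)
  moreover have "(\<Prod>j=1..CARD('n). 0 - lam j) = (- 1) ^ CARD('n) * (\<Prod>j=1..CARD('n). lam j)"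
    using prod.distrib[of "\<lambda>_. - 1" lam "{1..CARD('n)}"] by simp
  ultimately have "(- 1) ^ CARD('n) * det A = (- 1) ^ CARD('n) * (\<Prod>j=1..CARD('n). lam j)"
    using det_rows_mul[of "\<lambda>_. - 1" "\<lambda>i. A $ i"] by simp
  then show ?thesis by simp
qed

lemma prod_two_scales_bounds:
  fixes lam :: "nat \<Rightarrow> real"
  assumes "d \<le> n" "0 < c1" "0 < h"
    and "\<forall>j\<in>{1..d}. c1 * h\<^sup>2 \<le> lam j \<and> lam j \<le> c2 * h\<^sup>2"
    and "\<forall>j\<in>{d<..n}. c1 \<le> lam j \<and> lam j \<le> c2"
  shows "c1 ^ n * h ^ (2 * d) \<le> (\<Prod>j=1..n. lam j)" "(\<Prod>j=1..n. lam j) \<le> c2 ^ n * h ^ (2 * d)"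
proof -
  \<comment> \<open>\<open>s j\<close> is the order of magnitude of the \<open>j\<close>-th
    eigenvalue. The product of all \<open>s j\<close> is h^(2d), and the constants contribute an
    n-th power.\<close>
  define s where "s j = (if j \<le> d then h\<^sup>2 else 1)" for j
  have s: "(\<Prod>j=1..n. c * s j) = c ^ n * h ^ (2 * d)" for c
  proof -
    have "(\<Prod>j=1..n. s j) = (\<Prod>j\<in>{1..d}. h\<^sup>2) * (\<Prod>j\<in>{d<..n}. 1)"
    proof -
      have "{1..n} = {1..d} \<union> {d<..n}" using assms(1) by auto
      then have "(\<Prod>j=1..n. s j) = (\<Prod>j\<in>{1..d}. s j) * (\<Prod>j\<in>{d<..n}. s j)"
        by (simp only:) (rule prod.union_disjoint; auto)
      then show ?thesis by (simp add: s_def)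
    qed
    then show ?thesis by (simp add: prod.distrib power_mult)
  qed
  have "c1 * s j \<le> lam j \<and> lam j \<le> c2 * s j \<and> 0 \<le> c1 * s j" if "j \<in> {1..n}" for j
    using assms that by (cases "j \<le> d") (auto simp: s_def)
  then have "(\<Prod>j=1..n. c1 * s j) \<le> (\<Prod>j=1..n. lam j)" "(\<Prod>j=1..n. lam j) \<le> (\<Prod>j=1..n. c2 * s j)"
    by (intro prod_mono; force)+
  then show "c1 ^ n * h ^ (2 * d) \<le> (\<Prod>j=1..n. lam j)" "(\<Prod>j=1..n. lam j) \<le> c2 ^ n * h ^ (2 * d)"
    by (simp_all only: s)
qed

text \<open>Inversion exchanges the bounds: the lower constant \<open>c1\<close> of the spectrum
  governs the upper estimate and \<open>c2\<close> the lower one. The root reduces h^(2d) to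
  h^d.\<close>

lemma sqrt_det_matrix_inv_two_scales:
  fixes A :: "real^'n^'n"
  assumes inv: "invertible A" and lam: "eigenvalues_are A lam"
    and d: "d \<le> CARD('n)" and c: "0 < c1" "c1 \<le> c2" and h: "0 < h"
    and small: "\<forall>j\<in>{1..d}. c1 * h\<^sup>2 \<le> lam j \<and> lam j \<le> c2 * h\<^sup>2"
    and large: "\<forall>j\<in>{d<..CARD('n)}. c1 \<le> lam j \<and> lam j \<le> c2"
  shows "sqrt (det (matrix_inv A)) \<le> sqrt (1 / c1 ^ CARD('n)) * h powr (- real d)"
    and "sqrt (1 / c2 ^ CARD('n)) * h powr (- real d) \<le> sqrt (det (matrix_inv A))"
proof -
  have hp: "h powr (- real d) = sqrt (1 / h ^ (2 * d))"
    using h by (simp add: powr_minus powr_realpow real_sqrt_divide power_even_eq inverse_eq_divide)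
  have D: "c1 ^ CARD('n) * h ^ (2 * d) \<le> det A" "det A \<le> c2 ^ CARD('n) * h ^ (2 * d)"
    using prod_two_scales_bounds[OF d c(1) h small large] by (simp_all add: det_eigenvalues[OF lam])
  have pos: "0 < c1 ^ CARD('n) * h ^ (2 * d)" "0 < c2 ^ CARD('n) * h ^ (2 * d)" using c h by simp_all
  have "0 < det A" using D(1) pos by linarith
  note pos = pos this
  show "sqrt (det (matrix_inv A)) \<le> sqrt (1 / c1 ^ CARD('n)) * h powr (- real d)"
    unfolding hp real_sqrt_mult[symmetric] det_matrix_inv[OF inv] times_divide_times_eq mult_1
    using D pos c h by (intro real_sqrt_le_mono divide_left_mono mult_pos_pos) auto
  show "sqrt (1 / c2 ^ CARD('n)) * h powr (- real d) \<le> sqrt (det (matrix_inv A))"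
    unfolding hp real_sqrt_mult[symmetric] det_matrix_inv[OF inv] times_divide_times_eq mult_1
    using D pos c h by (intro real_sqrt_le_mono divide_left_mono mult_pos_pos) auto
qed

section \<open>Energy and effective dimension under the Gaussian bound\<close>

locale gaussian_bounded_kernel = prob_space P
  for P :: "(real^'n) measure" +
  fixes \<kappa> :: "real \<Rightarrow> real^'n \<Rightarrow> real^'n \<Rightarrow> real"
    and c0 C0 :: real
  assumes sets_P: "sets P = sets borel"
    and meas: "\<And>h. 0 < h \<Longrightarrow> (\<lambda>(v,u). \<kappa> h v u) \<in> borel_measurable borel"
    and nonneg: "\<And>h u v. 0 < h \<Longrightarrow> 0 \<le> \<kappa> h v u"
    and integrable: "\<And>h u. 0 < h \<Longrightarrow> integrable lborel (\<lambda>v. \<kappa> h v u)"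
    and integrable_square: "\<And>h u. 0 < h \<Longrightarrow> integrable lborel (\<lambda>v. \<kappa> h v u * (norm v)\<^sup>2)"
    and inv: "\<And>h u. 0 < h \<Longrightarrow> invertible (kcov \<kappa> h u)"
    and c0: "0 < c0" and C0: "0 < C0"
    and gauss: "\<And>h y. 0 < h \<Longrightarrow> AE u in P.
                  \<kappa> h y u \<le> C0 * sqrt (det (kprec \<kappa> h u))
                     * exp (- c0 * (Gnorm (kprec \<kappa> h u) (y - kmean \<kappa> h u))\<^sup>2)"
begin

text \<open>Squaring the Gaussian bound squares \<open>C0\<close> and doubles the rate to 2
  \<open>c0\<close>; the power is the Gaussian integral at that rate.\<close>

definition C :: real where
  "C = C0\<^sup>2 * (pi / (2 * c0)) powr (real CARD('n) / 2)"

lemma C_pos: "0 < C"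
  using c0 C0 by (simp add: C_def)

lemma pos: "0 < h \<Longrightarrow> x \<noteq> 0 \<Longrightarrow> 0 < x \<bullet> (kcov \<kappa> h u *v x)"
  using kcov_posdef[of \<kappa> h u x] nonneg integrable integrable_square inv by blast

lemma det_kprec_pos: "0 < h \<Longrightarrow> 0 < det (kprec \<kappa> h u)"
  unfolding kprec_def
  by (rule nn_integral_exp_neg_Gnorm(1)[OF kcov_symmetric pos zero_less_one])

lemma borel_measurable_kprec_nth:
  assumes h: "0 < h"
  shows "(\<lambda>u. kprec \<kappa> h u $ i $ j) \<in> borel_measurable borel"
  unfolding kprec_def
  by (intro borel_measurable_matrix_inv_nth borel_measurable_kcov_nth[of \<kappa> h, OF meas[OF h]] inv[OF h])

lemma borel_measurable_det_kprec:
  "0 < h \<Longrightarrow> (\<lambda>u. det (kprec \<kappa> h u)) \<in> borel_measurable borel"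
  by (intro borel_measurable_det borel_measurable_kprec_nth)

text \<open>The hypothesis excludes a null set depending on \<open>y\<close>; Fubini exchanges the quantifiers.\<close>

lemma gauss_AE:
  assumes h: "0 < h"
  shows "AE u in P. AE y in lborel. \<kappa> h y u \<le> C0 * sqrt (det (kprec \<kappa> h u))
                     * exp (- c0 * (Gnorm (kprec \<kappa> h u) (y - kmean \<kappa> h u))\<^sup>2)"
proof -
  interpret pair_sigma_finite lborel P
    by (intro pair_sigma_finite.intro sigma_finite_lborel sigma_finite_measure_axioms)
  note [measurable_cong] = sets_P
  have [measurable]: "(\<lambda>(v,u). \<kappa> h v u) \<in> borel_measurable (borel \<Otimes>\<^sub>M borel)"
    using meas[OF h] by (simp add: borel_prod)
  note [measurable] = borel_measurable_kprec_nth[OF h] borel_measurable_det_kprec[OF h]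
    borel_measurable_kmean_nth[of \<kappa> h, OF meas[OF h]]
  \<comment> \<open>Exchanging the almost-everywhere quantifiers requires the inequality to be
    measurable jointly in (y,u), so the norm is expanded into coordinates.\<close>
  have [measurable]: "(\<lambda>x. Gnorm (kprec \<kappa> h (snd x)) (fst x - kmean \<kappa> h (snd x)))
      \<in> borel_measurable (lborel \<Otimes>\<^sub>M P)"
    unfolding Gnorm_def inner_vec_def matrix_vector_mult_def vec_lambda_beta vector_minus_component
      inner_real_def by measurable
  have "(AE y in lborel. AE u in P. \<kappa> h y u \<le> C0 * sqrt (det (kprec \<kappa> h u))
            * exp (- c0 * (Gnorm (kprec \<kappa> h u) (y - kmean \<kappa> h u))\<^sup>2))
     \<longleftrightarrow> (AE u in P. AE y in lborel. \<kappa> h y u \<le> C0 * sqrt (det (kprec \<kappa> h u))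
            * exp (- c0 * (Gnorm (kprec \<kappa> h u) (y - kmean \<kappa> h u))\<^sup>2))"
    by (rule AE_commute) measurable
  then show ?thesis using gauss[OF h] by simp
qed

text \<open>The squared bound carries a full factor det G. One square root of it is absorbed as the
  Jacobian of the Gaussian integral, the other survives.\<close>

lemma energy_le:
  assumes h: "0 < h"
  shows "AE u in P. (\<integral>\<^sup>+y. ennreal ((\<kappa> h y u)\<^sup>2) \<partial>lebesgue) \<le> ennreal C * ennreal (sqrt (det (kprec \<kappa> h u)))"
  using gauss_AE[OF h]
proof eventually_elim
  case (elim u)
  let ?G = "kprec \<kappa> h u"
  let ?N = "\<lambda>y. Gnorm ?G (y - kmean \<kappa> h u)"
  have d: "0 < det ?G" by (rule det_kprec_pos[OF h])
  have [measurable]: "?N \<in> borel_measurable borel"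
    unfolding Gnorm_def inner_vec_def matrix_vector_mult_def vec_lambda_beta vector_minus_component
      inner_real_def by measurable
  have I: "ennreal (sqrt (det ?G)) * (\<integral>\<^sup>+y. ennreal (exp (- (2 * c0) * (?N y)\<^sup>2)) \<partial>lborel)
      = ennreal ((pi / (2 * c0)) powr (real CARD('n) / 2))"
    unfolding kprec_def
    using c0 by (intro nn_integral_exp_neg_Gnorm(2) kcov_symmetric pos h) auto
  have "(\<integral>\<^sup>+y. ennreal ((\<kappa> h y u)\<^sup>2) \<partial>lebesgue) = (\<integral>\<^sup>+y. ennreal ((\<kappa> h y u)\<^sup>2) \<partial>lborel)"
    by (rule nn_integral_completion)
  also have "\<dots> \<le> (\<integral>\<^sup>+y. ennreal (C0\<^sup>2 * det ?G) * ennreal (exp (- (2 * c0) * (?N y)\<^sup>2)) \<partial>lborel)"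
  proof (rule nn_integral_mono_AE, use elim in eventually_elim)
    case (elim y)
    have "(\<kappa> h y u)\<^sup>2 \<le> (C0 * sqrt (det ?G) * exp (- c0 * (?N y)\<^sup>2))\<^sup>2"
      using elim nonneg[OF h] by (intro power_mono) auto
    also have "\<dots> = C0\<^sup>2 * det ?G * exp (- (2 * c0) * (?N y)\<^sup>2)"
      using d by (simp add: power_mult_distrib flip: exp_double)
    finally show ?case using d by (simp add: ennreal_leI flip: ennreal_mult)
  qed
  also have "\<dots> = ennreal (C0\<^sup>2 * det ?G) * (\<integral>\<^sup>+y. ennreal (exp (- (2 * c0) * (?N y)\<^sup>2)) \<partial>lborel)"
    by (rule nn_integral_cmult) measurable
  \<comment> \<open>det G is split into two square roots, the second of which meets the integral in
    the form of \<open>I\<close>.\<close>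
  also have "ennreal (C0\<^sup>2 * det ?G) = ennreal (C0\<^sup>2 * sqrt (det ?G)) * ennreal (sqrt (det ?G))"
    using d by (simp flip: ennreal_mult)
  also have "\<dots> * (\<integral>\<^sup>+y. ennreal (exp (- (2 * c0) * (?N y)\<^sup>2)) \<partial>lborel)
      = ennreal (C0\<^sup>2 * sqrt (det ?G)) * ennreal ((pi / (2 * c0)) powr (real CARD('n) / 2))"
    by (simp only: mult.assoc I)
  also have "\<dots> = ennreal C * ennreal (sqrt (det ?G))"
    using d c0 by (simp add: C_def mult_ac flip: ennreal_mult)
  finally show ?case .
qed

lemma Hh_le:
  assumes h: "0 < h"
    and E: "(\<integral>\<^sup>+u. ennreal (sqrt (det (kprec \<kappa> h u))) \<partial>P) \<le> ennreal x"
  shows "Hh P \<kappa> h UNIV \<le> ennreal (C * x)"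
proof -
  note [measurable_cong] = sets_P
  note [measurable] = borel_measurable_det_kprec[OF h]
  have "Hh P \<kappa> h UNIV \<le> (\<integral>\<^sup>+u. ennreal C * ennreal (sqrt (det (kprec \<kappa> h u))) \<partial>P)"
    unfolding Hh_UNIV by (rule nn_integral_mono_AE[OF energy_le[OF h]])
  also have "\<dots> = ennreal C * (\<integral>\<^sup>+u. ennreal (sqrt (det (kprec \<kappa> h u))) \<partial>P)"
    by (rule nn_integral_cmult) measurable
  also have "\<dots> \<le> ennreal C * ennreal x"
    by (rule mult_left_mono[OF E]) simp
  also have "\<dots> = ennreal (C * x)"
    using C_pos by (simp add: ennreal_mult')
  finally show ?thesis .
qed

text \<open>The bounds of (a) at a fixed h. A general set enters only through monotonicity of the
  energy in the set.\<close>

lemma power_bound: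
  assumes r: "\<And>h. 0 \<le> r h"
    and E: "\<And>h. 0 < h \<Longrightarrow> h \<le> hr \<Longrightarrow>
        (\<integral>\<^sup>+u. ennreal (sqrt (det (kprec \<kappa> h u))) \<partial>P) \<le> ennreal (Cr * h powr (- r h))"
    and h: "0 < h" "h \<le> hr"
  shows "Hh P \<kappa> h UNIV \<le> ennreal (C * Cr * h powr (- r h))"
    and "h < 1 \<Longrightarrow> deff P \<kappa> h Y \<le> r h + ln (max (C * Cr) 1) / ln (1 / h)"
proof -
  show H: "Hh P \<kappa> h UNIV \<le> ennreal (C * Cr * h powr (- r h))"
    using Hh_le[OF h(1) E[OF h]] by (simp add: mult.assoc)
  show "deff P \<kappa> h Y \<le> r h + ln (max (C * Cr) 1) / ln (1 / h)" if "h < 1"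
    using h(1) that r order_trans[OF Hh_mono H] by (intro deff_le) auto
qed

lemma deff_limsup_le:
  assumes r: "\<And>h. 0 \<le> r h" and hr: "0 < hr"
    and E: "\<And>h. 0 < h \<Longrightarrow> h \<le> hr \<Longrightarrow>
        (\<integral>\<^sup>+u. ennreal (sqrt (det (kprec \<kappa> h u))) \<partial>P) \<le> ennreal (Cr * h powr (- r h))"
    and rs: "Limsup (at_right 0) (\<lambda>h. ereal (r h)) \<le> ereal rs"
  shows "\<exists>g::real \<Rightarrow> real. (g \<longlongrightarrow> 0) (at_right 0) \<and> (\<forall>\<^sub>F h in at_right 0. deff P \<kappa> h Y \<le> rs + g h)"
proof (intro exI conjI)
  let ?e = "\<lambda>h. ln (max (C * Cr) 1) / ln (1 / h)"
  \<comment> \<open>Only the excess of r over its limsup bound has to vanish, since r may stay well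
    below \<open>rs\<close>. The positive part therefore serves in the o(1) term.\<close>
  have "((\<lambda>h. max 0 (r h - rs)) \<longlongrightarrow> 0) (at_right 0)"
  proof (rule tendstoI)
    fix e :: real assume "0 < e"
    then have "Limsup (at_right 0) (\<lambda>h. ereal (r h)) < ereal (rs + e)"
      using rs by (intro le_less_trans[OF rs]) simp
    then have "\<forall>\<^sub>F h in at_right 0. ereal (r h) < ereal (rs + e)" by (rule Limsup_lessD)
    then show "\<forall>\<^sub>F h in at_right 0. dist (max 0 (r h - rs)) 0 < e"
      by eventually_elim (use \<open>0 < e\<close> in auto)
  qed
  from tendsto_add[OF this tendsto_const_over_ln_inverse[of "ln (max (C * Cr) 1)"]]
  show "((\<lambda>h. max 0 (r h - rs) + ?e h) \<longlongrightarrow> 0) (at_right 0)" by simp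
  have "\<forall>\<^sub>F h in at_right 0. h \<in> {0<..<min hr 1}"
    using hr by (intro eventually_at_right_real) auto
  then show "\<forall>\<^sub>F h in at_right 0. deff P \<kappa> h Y \<le> rs + (max 0 (r h - rs) + ?e h)"
  proof eventually_elim
    case (elim h)
    then have "deff P \<kappa> h Y \<le> r h + ?e h"
      using power_bound(2)[of r hr Cr h Y] r E by auto
    then show ?case by linarith
  qed
qed

section \<open>Covariance spectra with \<open>d\<close> small eigenvalues\<close>

context
  fixes d :: nat and c1 c2 h0 :: real
  assumes d: "d \<le> CARD('n)" and c: "0 < c1" "c1 \<le> c2" and h0: "0 < h0"
    and ev: "AE u in P. \<forall>h. 0 < h \<and> h \<le> h0 \<longrightarrow>
            (\<exists>lam. eigenvalues_are (kcov \<kappa> h u) lam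
               \<and> (\<forall>j\<in>{1..d}. c1 * h\<^sup>2 \<le> lam j \<and> lam j \<le> c2 * h\<^sup>2)
               \<and> (\<forall>j\<in>{d<..CARD('n)}. c1 \<le> lam j \<and> lam j \<le> c2))"
begin

lemma sqrt_det_kprec_two_scales:
  assumes h: "0 < h" "h \<le> h0"
  shows "AE u in P. sqrt (det (kprec \<kappa> h u)) \<le> sqrt (1 / c1 ^ CARD('n)) * h powr (- real d)
                 \<and> sqrt (1 / c2 ^ CARD('n)) * h powr (- real d) \<le> sqrt (det (kprec \<kappa> h u))"
  using ev
proof eventually_elim
  case (elim u)
  with h obtain lam where "eigenvalues_are (kcov \<kappa> h u) lam"
    "\<forall>j\<in>{1..d}. c1 * h\<^sup>2 \<le> lam j \<and> lam j \<le> c2 * h\<^sup>2"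
    "\<forall>j\<in>{d<..CARD('n)}. c1 \<le> lam j \<and> lam j \<le> c2" by blast
  from sqrt_det_matrix_inv_two_scales[OF inv[OF h(1)] this(1) d c h(1) this(2,3)]
  show ?case by (simp add: kprec_def)
qed

lemma expectation_sqrt_det_le:
  assumes h: "0 < h" "h \<le> h0"
  shows "(\<integral>\<^sup>+u. ennreal (sqrt (det (kprec \<kappa> h u))) \<partial>P)
           \<le> ennreal (sqrt (1 / c1 ^ CARD('n)) * h powr (- real d))"
proof -
  have "(\<integral>\<^sup>+u. ennreal (sqrt (det (kprec \<kappa> h u))) \<partial>P)
      \<le> (\<integral>\<^sup>+u. ennreal (sqrt (1 / c1 ^ CARD('n)) * h powr (- real d)) \<partial>P)"
    using sqrt_det_kprec_two_scales[OF h]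
    by (intro nn_integral_mono_AE) (auto elim!: eventually_mono intro: ennreal_leI)
  then show ?thesis by (simp add: emeasure_space_1)
qed

lemma Hh_le_two_scales:
  assumes h: "0 < h" "h \<le> h0"
  shows "Hh P \<kappa> h UNIV \<le> ennreal (C * sqrt (1 / c1 ^ CARD('n)) * h powr (- real d))"
  using power_bound(1)[where r = "\<lambda>_. real d" and hr = h0, OF of_nat_0_le_iff expectation_sqrt_det_le] h
  by blast

text \<open>The case of (a) in which the exponent is the constant function \<open>d\<close>, whose
  limsup is \<open>d\<close> itself.\<close>

lemma deff_le_two_scales:
  "\<exists>g::real \<Rightarrow> real. (g \<longlongrightarrow> 0) (at_right 0) \<and> (\<forall>\<^sub>F h in at_right 0. deff P \<kappa> h Y \<le> real d + g h)"
  by (rule deff_limsup_le[where r = "\<lambda>_. real d", OF of_nat_0_le_iff h0 expectation_sqrt_det_le])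
     (simp_all add: Limsup_const)

text \<open>The lower half of the determinant estimate turns the assumed energy bound into a
  deterministic constant, whose expectation is itself.\<close>

lemma Hh_ge_two_scales:
  assumes h: "0 < h" "h \<le> h0" and cl: "0 < cl"
    and lower: "AE u in P. (\<integral>\<^sup>+ y. ennreal ((\<kappa> h y u)\<^sup>2) \<partial>lebesgue) \<ge> ennreal (cl * sqrt (det (kprec \<kappa> h u)))"
  shows "ennreal (cl * sqrt (1 / c2 ^ CARD('n)) * h powr (- real d)) \<le> Hh P \<kappa> h UNIV"
proof -
  have "(\<integral>\<^sup>+u. ennreal (cl * sqrt (1 / c2 ^ CARD('n)) * h powr (- real d)) \<partial>P) \<le> Hh P \<kappa> h UNIV"
    unfolding Hh_UNIV
  proof (rule nn_integral_mono_AE, use lower sqrt_det_kprec_two_scales[OF h] in eventually_elim)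
    case (elim u)
    have "cl * sqrt (1 / c2 ^ CARD('n)) * h powr (- real d) \<le> cl * sqrt (det (kprec \<kappa> h u))"
      using elim(2) cl by (simp only: mult.assoc) (intro mult_left_mono; simp)
    then show ?case using elim(1) by (meson ennreal_leI order_trans)
  qed
  then show ?thesis by (simp add: emeasure_space_1)
qed

lemma deff_tendsto_two_scales:
  assumes cl: "0 < cl" and h0': "0 < h0'"
    and lower: "\<And>h. 0 < h \<Longrightarrow> h \<le> h0' \<Longrightarrow>
       AE u in P. (\<integral>\<^sup>+ y. ennreal ((\<kappa> h y u)\<^sup>2) \<partial>lebesgue) \<ge> ennreal (cl * sqrt (det (kprec \<kappa> h u)))"
  shows "((\<lambda>h. deff P \<kappa> h UNIV) \<longlongrightarrow> real d) (at_right 0)"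
proof (rule tendsto_sandwich)
  \<comment> \<open>Both sandwiching functions are \<open>d\<close> plus a constant over ln(1/h).
    The upper constant is capped below by 1 as in \<open>deff_le\<close>; the lower one only has to
    be positive, since its logarithm may have any sign.\<close>
  let ?b = "cl * sqrt (1 / c2 ^ CARD('n))" and ?a = "max (C * sqrt (1 / c1 ^ CARD('n))) 1"
  have b: "0 < ?b" using cl c by simp
  have ev: "\<forall>\<^sub>F h in at_right 0. h \<in> {0<..<min (min h0 h0') 1}"
    using h0 h0' by (intro eventually_at_right_real) auto
  show "\<forall>\<^sub>F h in at_right 0. real d + ln ?b / ln (1 / h) \<le> deff P \<kappa> h UNIV"
    using ev
  proof eventually_elim
    case (elim h)
    then have h: "0 < h" "h < 1" "h \<le> h0" "h \<le> h0'" by auto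
    \<comment> \<open>The upper bound supplies the finiteness that the lower estimate of
      \<open>deff\<close> requires.\<close>
    have "Hh P \<kappa> h UNIV < \<infinity>"
      using Hh_le_two_scales[OF h(1,3)] by (rule le_less_trans) simp
    then show ?case
      using h by (intro deff_ge b Hh_ge_two_scales cl lower)
  qed
  show "\<forall>\<^sub>F h in at_right 0. deff P \<kappa> h UNIV \<le> real d + ln ?a / ln (1 / h)"
    using ev
  proof eventually_elim
    case (elim h)
    then show ?case
      using power_bound(2)[where r = "\<lambda>_. real d" and hr = h0, OF of_nat_0_le_iff expectation_sqrt_det_le] by auto
  qed
  show "((\<lambda>h. real d + ln ?b / ln (1 / h)) \<longlongrightarrow> real d) (at_right 0)"
       "((\<lambda>h. real d + ln ?a / ln (1 / h)) \<longlongrightarrow> real d) (at_right 0)"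
    using tendsto_add[OF tendsto_const tendsto_const_over_ln_inverse] by force+
qed

end

end

section \<open>Assembly of (a) and (b)\<close>

theorem theorem3:
  fixes P :: "(real^'n) measure"
    and \<kappa> :: "real \<Rightarrow> real^'n \<Rightarrow> real^'n \<Rightarrow> real"
    and c0 C0 :: real
  assumes law: "prob_space P" "sets P = sets borel"
    and meas: "\<forall>h>0. (\<lambda>(v,u). \<kappa> h v u) \<in> borel_measurable borel"
    and dens: "\<forall>h>0. \<forall>u. (\<forall>v. 0 \<le> \<kappa> h v u)
                 \<and> integrable lborel (\<lambda>v. \<kappa> h v u) \<and> (LINT v|lborel. \<kappa> h v u) = 1
                 \<and> integrable lborel (\<lambda>v. \<kappa> h v u * norm v)
                 \<and> integrable lborel (\<lambda>v. \<kappa> h v u * (norm v)\<^sup>2)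
                 \<and> invertible (kcov \<kappa> h u)"
    and c0: "c0 > 0" and C0: "C0 > 0"
    and gauss: "\<forall>h>0. \<forall>y. AE u in P.
                  \<kappa> h y u \<le> C0 * sqrt (det (kprec \<kappa> h u))
                     * exp (- c0 * (Gnorm (kprec \<kappa> h u) (y - kmean \<kappa> h u))\<^sup>2)"
  shows
   "(\<forall>hr (r::real \<Rightarrow> real) Cr::real.
       hr > 0 \<and> (\<forall>h. 0 \<le> r h)
       \<and> (\<forall>h. 0 < h \<and> h \<le> hr \<longrightarrow>
            (\<integral>\<^sup>+ u. ennreal (sqrt (det (kprec \<kappa> h u))) \<partial>P) \<le> ennreal (Cr * h powr (- r h)))
     \<longrightarrow>
       (\<forall>Y0 \<in> sets lebesgue. \<forall>h. 0 < h \<and> h \<le> hr \<and> h < 1 \<longrightarrow>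
            Hh P \<kappa> h Y0 \<le> Hh P \<kappa> h UNIV
          \<and> Hh P \<kappa> h UNIV \<le> ennreal (C0\<^sup>2 * (pi / (2 * c0)) powr (real CARD('n) / 2) * Cr * h powr (- r h))
          \<and> deff P \<kappa> h Y0 \<le> r h + ln (max (C0\<^sup>2 * (pi / (2 * c0)) powr (real CARD('n) / 2) * Cr) 1) / ln (1 / h))
     \<and> (\<forall>rs::real. Limsup (at_right 0) (\<lambda>h. ereal (r h)) \<le> ereal rs \<longrightarrow>
          (\<forall>Y0 \<in> sets lebesgue. \<exists>g::real \<Rightarrow> real. (g \<longlongrightarrow> 0) (at_right 0)
              \<and> (\<forall>\<^sub>F h in at_right 0. deff P \<kappa> h Y0 \<le> rs + g h))))
  \<and> (\<forall>(ds::nat) c1 c2 h0::real.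
       ds \<le> CARD('n) \<and> 0 < c1 \<and> c1 \<le> c2 \<and> 0 < h0
       \<and> (AE u in P. \<forall>h. 0 < h \<and> h \<le> h0 \<longrightarrow>
            (\<exists>lam. eigenvalues_are (kcov \<kappa> h u) lam
               \<and> (\<forall>j\<in>{1..ds}. c1 * h\<^sup>2 \<le> lam j \<and> lam j \<le> c2 * h\<^sup>2)
               \<and> (\<forall>j\<in>{ds<..CARD('n)}. c1 \<le> lam j \<and> lam j \<le> c2)))
     \<longrightarrow>
       (\<forall>Y0 \<in> sets lebesgue.
            (\<forall>h>0. Hh P \<kappa> h Y0 \<le> Hh P \<kappa> h UNIV)
          \<and> (\<exists>K::real. \<forall>h. 0 < h \<and> h \<le> h0 \<longrightarrow> Hh P \<kappa> h UNIV \<le> ennreal (K * h powr (- real ds)))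
          \<and> (\<exists>g::real \<Rightarrow> real. (g \<longlongrightarrow> 0) (at_right 0)
              \<and> (\<forall>\<^sub>F h in at_right 0. deff P \<kappa> h Y0 \<le> real ds + g h)))
     \<and> (\<forall>cl h0'::real. 0 < cl \<and> 0 < h0'
          \<and> (\<forall>h. 0 < h \<and> h \<le> h0' \<longrightarrow>
               (AE u in P. (\<integral>\<^sup>+ y. ennreal ((\<kappa> h y u)\<^sup>2) \<partial>lebesgue)
                              \<ge> ennreal (cl * sqrt (det (kprec \<kappa> h u)))))
        \<longrightarrow> ((\<lambda>h. deff P \<kappa> h UNIV) \<longlongrightarrow> real ds) (at_right 0)))"
proof -
  interpret gaussian_bounded_kernel P \<kappa> c0 C0
    using law meas dens c0 C0 gauss
    by (intro gaussian_bounded_kernel.intro gaussian_bounded_kernel_axioms.intro) simp_all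
  \<comment> \<open>Folding the explicit constant into \<open>C\<close> lets the goals match the
    results proved for the kernel.\<close>
  note C_eq = C_def[symmetric]
  show ?thesis
    unfolding C_eq
  proof (intro conjI allI impI ballI; (elim conjE)?)
    fix hr :: real and r Cr Y0 h
    assume "\<forall>h. 0 \<le> r h"
      "\<forall>h. 0 < h \<and> h \<le> hr \<longrightarrow> (\<integral>\<^sup>+ u. ennreal (sqrt (det (kprec \<kappa> h u))) \<partial>P) \<le> ennreal (Cr * h powr (- r h))"
      "0 < h" "h \<le> hr" "h < 1"
    then show "Hh P \<kappa> h UNIV \<le> ennreal (C * Cr * h powr (- r h))"
      "deff P \<kappa> h Y0 \<le> r h + ln (max (C * Cr) 1) / ln (1 / h)"
      using power_bound(1)[of r hr Cr h] power_bound(2)[of r hr Cr h Y0] by auto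
  next
    fix hr :: real and r Cr rs Y0
    assume "0 < hr" "\<forall>h. 0 \<le> r h"
      "\<forall>h. 0 < h \<and> h \<le> hr \<longrightarrow> (\<integral>\<^sup>+ u. ennreal (sqrt (det (kprec \<kappa> h u))) \<partial>P) \<le> ennreal (Cr * h powr (- r h))"
      "Limsup (at_right 0) (\<lambda>h. ereal (r h)) \<le> ereal rs"
    then show "\<exists>g::real \<Rightarrow> real. (g \<longlongrightarrow> 0) (at_right 0) \<and> (\<forall>\<^sub>F h in at_right 0. deff P \<kappa> h Y0 \<le> rs + g h)"
      by (intro deff_limsup_le[of r hr Cr rs Y0]) auto
  next
    fix ds :: nat and c1 c2 h0 :: real and Y0
    assume A: "ds \<le> CARD('n)" "0 < c1" "c1 \<le> c2" "0 < h0"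
      "AE u in P. \<forall>h. 0 < h \<and> h \<le> h0 \<longrightarrow>
            (\<exists>lam. eigenvalues_are (kcov \<kappa> h u) lam
               \<and> (\<forall>j\<in>{1..ds}. c1 * h\<^sup>2 \<le> lam j \<and> lam j \<le> c2 * h\<^sup>2)
               \<and> (\<forall>j\<in>{ds<..CARD('n)}. c1 \<le> lam j \<and> lam j \<le> c2))"
    show "\<exists>K::real. \<forall>h. 0 < h \<and> h \<le> h0 \<longrightarrow> Hh P \<kappa> h UNIV \<le> ennreal (K * h powr (- real ds))"
      using Hh_le_two_scales[OF A] by blast
    show "\<exists>g::real \<Rightarrow> real. (g \<longlongrightarrow> 0) (at_right 0)
              \<and> (\<forall>\<^sub>F h in at_right 0. deff P \<kappa> h Y0 \<le> real ds + g h)"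
      by (rule deff_le_two_scales[OF A])
    show "((\<lambda>h. deff P \<kappa> h UNIV) \<longlongrightarrow> real ds) (at_right 0)"
      if "0 < cl" "0 < h0'" "\<forall>h. 0 < h \<and> h \<le> h0' \<longrightarrow>
               (AE u in P. (\<integral>\<^sup>+ y. ennreal ((\<kappa> h y u)\<^sup>2) \<partial>lebesgue)
                              \<ge> ennreal (cl * sqrt (det (kprec \<kappa> h u))))" for cl h0'
      by (rule deff_tendsto_two_scales[OF A that(1,2)]) (use that(3) in blast)
  \<comment> \<open>The goals left over compare the energy on \<open>Y0\<close> with that on the
    whole space, in (a) and in (b).\<close>
  qed (auto intro: Hh_mono)
qed

end
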